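(* For every $n\ge1$: (1) $|T_n|=\frac{1}{n}L_n$; (2) $|\mathcal{IS}_n|=\frac{1}{n+1}L^{(n+1)}$.
   Context: For $m\ge1$ let $\mathcal{IS}_m$ be the symmetric inverse semigroup of all partial injective maps from $\{1,\dots,m\}$ to itself (bijections between subsets $\operatorname{dom}(\alpha)$ and $\operatorname{im}(\alpha)$; the empty map, denoted $0$, is the zero element), under composition of partial maps. $T_m\subseteq\mathcal{IS}_m$ is the set of nilpotent elements, i.e. those $\alpha$ with $\alpha^r=0$ for some $r>0$. The graph of the action of $\alpha$ has an arrow $x\to\alpha(x)$ for each $x\in\operatorname{dom}(\alpha)$; each connected component is either a directed cycle or a directed path $a_1\to\dots\to a_k$, $k\ge1$, with $a_1\notin\operatorname{im}(\alpha)$, $a_k\notin\operatorname{dom}(\alpha)$ (a "chain"; a chain of length 1 is a point outside $\operatorname{dom}(\alpha)\cup\operatorname{im}(\alpha)$). $L_m$ is the total number of chains in the chain decompositions of all elements of $\mathcal{IS}_m$, and $L^{(m)}$ is the total number of chains in the chain decompositions of all elements of $T_m$. *)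

theory Defs
  imports Complex_Main "HOL-Algebra.Group"
begin

(* Elements are partial maps on nat supported in {1..m}; the identity element is only
   used through powers, and the composition is that of functions (right factor first). *)
definition sym_inv :: "nat \<Rightarrow> (nat \<rightharpoonup> nat) monoid" where
  "sym_inv m = \<lparr>
     carrier = {\<alpha>. dom \<alpha> \<subseteq> {1..m} \<and> ran \<alpha> \<subseteq> {1..m} \<and> inj_on \<alpha> (dom \<alpha>)},
     mult = (\<circ>\<^sub>m),
     one = Some |` {1..m}\<rparr>"

abbreviation IS :: "nat \<Rightarrow> (nat \<rightharpoonup> nat) set" where
  "IS m \<equiv> carrier (sym_inv m)"

definition nilpotents :: "nat \<Rightarrow> (nat \<rightharpoonup> nat) set" where
  "nilpotents m = {\<alpha> \<in> IS m. \<exists>r::nat. r > 0 \<and> \<alpha> [^]\<^bsub>sym_inv m\<^esub> r = Map.empty}"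

(* Weakly connected components (as vertex sets) of the graph of the action on {1..m}.
   The vertex set has to be given explicitly, since points outside dom and ran of the
   map are components as well. *)
definition components :: "nat \<Rightarrow> (nat \<rightharpoonup> nat) \<Rightarrow> nat set set" where
  "components m \<alpha> = {1..m} // (Map.graph \<alpha> \<union> (Map.graph \<alpha>)\<inverse>)\<^sup>*"

definition chain_path :: "(nat \<rightharpoonup> nat) \<Rightarrow> nat list \<Rightarrow> bool" where
  "chain_path \<alpha> as \<longleftrightarrow> as \<noteq> [] \<and> distinct as \<and>
     (\<forall>i. Suc i < length as \<longrightarrow> \<alpha> (as ! i) = Some (as ! Suc i)) \<and>
     hd as \<notin> ran \<alpha> \<and> last as \<notin> dom \<alpha>"

definition chains :: "nat \<Rightarrow> (nat \<rightharpoonup> nat) \<Rightarrow> nat set set" where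
  "chains m \<alpha> = {C \<in> components m \<alpha>. \<exists>as. chain_path \<alpha> as \<and> set as = C}"

definition L_all :: "nat \<Rightarrow> nat" where
  "L_all m = (\<Sum>\<alpha>\<in>IS m. card (chains m \<alpha>))"

definition L_nil :: "nat \<Rightarrow> nat" where
  "L_nil m = (\<Sum>\<alpha>\<in>nilpotents m. card (chains m \<alpha>))"

end

theory Submission
  imports Defs
begin

text \<open>
  Both identities hold rank by rank. Let \<open>I(m,k)\<close> and \<open>T(m,k)\<close> be the numbers of all and of nilpotent
  elements of \<open>IS m\<close> whose domain has \<open>k\<close> points. Every chain has exactly one starting point, and the
  starting points are the points outside the range, so an element of rank \<open>k\<close> has exactly \<open>m - k\<close>
  chains (\<open>card_chains\<close>). Hence \<open>L_all m\<close> is the sum of the \<open>(m - k) I(m,k)\<close>, and \<open>L_nil m\<close> that of the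
  \<open>(m - k) T(m,k)\<close>.

  Counting elements with one marked arrow relates consecutive ranks. Erasing the marked arrow
  \<open>e \<rightarrow> s\<close> leaves an element of rank one less in which \<open>e\<close> is the end of a chain and \<open>s\<close> the
  start of a chain, and every such pair \<open>(e, s)\<close> can be joined again (\<open>marked_arc_count\<close>). Among
  all elements this gives
    \<open>(k + 1) I(m,k+1) = (m - k)^2 I(m,k)\<close>.
  An element is nilpotent iff its graph has no cycle (\<open>nilpotent_iff_acyclic\<close>). Joining the end of a
  chain to a start keeps the graph acyclic iff the start belongs to a different chain, so for nilpotents
    \<open>(k + 1) T(m,k+1) = (m - k) (m - k - 1) T(m,k)\<close>.

  Since \<open>I(m,0) = T(m,0) = 1\<close>, induction on \<open>k\<close> yields \<open>m T(m,k) = (m - k) I(m,k)\<close> and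
  \<open>(m + 1) I(m,k) = (m + 1 - k) T(m+1,k)\<close>. Summing the first over \<open>k\<close> gives part (1), and summing
  the second gives part (2).
\<close>

section \<open>Partial injections\<close>

lemma single_valued_relpow_add:
  "single_valued R \<Longrightarrow> (x, y) \<in> R ^^ n \<Longrightarrow> (x, z) \<in> R ^^ (n + k) \<Longrightarrow> (y, z) \<in> R ^^ k"
  by (auto simp: relpow_add dest: single_valuedD[OF single_valued_relpow])

lemma single_valued_graph: "single_valued (Map.graph f)"
  by (auto simp: single_valued_def graph_def)

lemma finite_IS: "finite (IS m)"
proof (rule finite_subset)
  show "IS m \<subseteq> {f. dom f \<subseteq> {1..m} \<and> ran f \<subseteq> {1..m}}"
    by (auto simp: sym_inv_def)
  have "finite (\<Union>A\<in>Pow {1..m}. {f::nat \<rightharpoonup> nat. dom f = A \<and> ran f \<subseteq> {1..m}})"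
    by (intro finite_UN_I finite_set_of_finite_maps) (auto intro: finite_subset)
  moreover have "{f::nat \<rightharpoonup> nat. dom f \<subseteq> {1..m} \<and> ran f \<subseteq> {1..m}} \<subseteq>
     (\<Union>A\<in>Pow {1..m}. {f. dom f = A \<and> ran f \<subseteq> {1..m}})" by auto
  ultimately show "finite {f::nat \<rightharpoonup> nat. dom f \<subseteq> {1..m} \<and> ran f \<subseteq> {1..m}}"
    by (rule rev_finite_subset)
qed

context
  fixes m :: nat and \<alpha> :: "nat \<rightharpoonup> nat"
  assumes \<alpha>: "\<alpha> \<in> IS m"
begin

lemma IS_dom: "dom \<alpha> \<subseteq> {1..m}" and IS_ran: "ran \<alpha> \<subseteq> {1..m}"
  and IS_inj: "inj_on \<alpha> (dom \<alpha>)"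
  using \<alpha> by (auto simp: sym_inv_def)

lemma IS_finite_dom: "finite (dom \<alpha>)"
  using IS_dom finite_subset by blast

lemma IS_card_dom_le: "card (dom \<alpha>) \<le> m"
  using card_mono[OF _ IS_dom] by simp

lemma IS_card_ran: "card (ran \<alpha>) = card (dom \<alpha>)"
proof -
  have "bij_betw (\<lambda>x. the (\<alpha> x)) (dom \<alpha>) (ran \<alpha>)"
    unfolding bij_betw_def
  proof
    show "inj_on (\<lambda>x. the (\<alpha> x)) (dom \<alpha>)"
      using IS_inj by (auto simp: inj_on_def dom_def)
    show "(\<lambda>x. the (\<alpha> x)) ` dom \<alpha> = ran \<alpha>"
    proof (intro subset_antisym subsetI)
      fix y assume "y \<in> ran \<alpha>"
      then obtain x where "\<alpha> x = Some y" by (auto simp: ran_def)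
      then show "y \<in> (\<lambda>x. the (\<alpha> x)) ` dom \<alpha>" by (intro image_eqI[of _ _ x]) auto
    qed (auto simp: ran_def)
  qed
  then show ?thesis by (rule bij_betw_same_card[symmetric])
qed

lemma IS_card_non_dom: "card ({1..m} - dom \<alpha>) = m - card (dom \<alpha>)"
  using IS_dom IS_finite_dom by (simp add: card_Diff_subset)

lemma IS_card_non_ran: "card ({1..m} - ran \<alpha>) = m - card (dom \<alpha>)"
  using IS_ran by (simp add: card_Diff_subset IS_card_ran finite_subset[OF IS_ran])

lemma IS_eq_source: "\<alpha> x = Some z \<Longrightarrow> \<alpha> y = Some z \<Longrightarrow> x = y"
  using IS_inj by (metis domI inj_on_def)

lemma finite_graph_IS: "finite (Map.graph \<alpha>)"
  using IS_finite_dom by (simp add: finite_graph_iff_finite_dom)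

section \<open>Chains and rank\<close>

text \<open>
  No arrow enters a start, and an injective map has at most one arrow into any other point. So a
  backward step out of the forward orbit of a start only retraces the last forward step, and the
  undirected component is that orbit.
\<close>

lemma component_of_start:
  assumes "s \<notin> ran \<alpha>"
  shows "(Map.graph \<alpha> \<union> (Map.graph \<alpha>)\<inverse>)\<^sup>* `` {s} = (Map.graph \<alpha>)\<^sup>* `` {s}"
proof
  have "(s, y) \<in> (Map.graph \<alpha>)\<^sup>*" if "(s, y) \<in> (Map.graph \<alpha> \<union> (Map.graph \<alpha>)\<inverse>)\<^sup>*" for y
    using that
  proof (induction rule: rtrancl_induct)
    case (step y z)
    show ?case
    proof (cases "(y, z) \<in> Map.graph \<alpha>")
      case True
      then show ?thesis using step.IH by simp
    next
      case False
      then have zy: "\<alpha> z = Some y" using step.hyps by (auto simp: graph_def)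
      then have "y \<noteq> s" using assms by (auto simp: ran_def)
      then obtain w where "(s, w) \<in> (Map.graph \<alpha>)\<^sup>*" "\<alpha> w = Some y"
        using step.IH by (auto elim: rtranclE simp: graph_def)
      then show ?thesis using IS_eq_source[OF zy] by simp
    qed
  qed simp
  then show "(Map.graph \<alpha> \<union> (Map.graph \<alpha>)\<inverse>)\<^sup>* `` {s} \<subseteq> (Map.graph \<alpha>)\<^sup>* `` {s}" by blast
  show "(Map.graph \<alpha>)\<^sup>* `` {s} \<subseteq> (Map.graph \<alpha> \<union> (Map.graph \<alpha>)\<inverse>)\<^sup>* `` {s}"
    using rtrancl_mono[of "Map.graph \<alpha>" "Map.graph \<alpha> \<union> (Map.graph \<alpha>)\<inverse>"] by blast
qed

lemma reachable_in_range: "(s, y) \<in> (Map.graph \<alpha>)\<^sup>* \<Longrightarrow> y = s \<or> y \<in> ran \<alpha>"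
  by (erule rtranclE) (auto simp: graph_def ran_def)

lemma reaching_in_domain: "(x, y) \<in> (Map.graph \<alpha>)\<^sup>* \<Longrightarrow> x = y \<or> x \<in> dom \<alpha>"
  by (erule converse_rtranclE) (auto simp: graph_def)

text \<open>
  A longest repetition-free path from a start is a chain: if its last point had an image, then either
  this image is new and prolongs the path, or it already occurs on the path. In the latter case it is
  the start, which has no preimage, or it has two preimages, contrary to injectivity.
\<close>

lemma chain_path_from_start:
  assumes s: "s \<in> {1..m}" "s \<notin> ran \<alpha>"
  obtains as where "chain_path \<alpha> as" "set as = (Map.graph \<alpha>)\<^sup>* `` {s}"
proof -
  define path where "path as \<longleftrightarrow> as \<noteq> [] \<and> hd as = s \<and> distinct as \<and>
     (\<forall>i. Suc i < length as \<longrightarrow> \<alpha> (as ! i) = Some (as ! Suc i))" for as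
  have reach: "set as \<subseteq> (Map.graph \<alpha>)\<^sup>* `` {s}" if "path as" for as
  proof -
    have "(s, as ! i) \<in> (Map.graph \<alpha>)\<^sup>*" if "i < length as" for i
      using that
    proof (induction i)
      case 0
      then show ?case using \<open>path as\<close> by (simp add: path_def hd_conv_nth)
    next
      case (Suc i)
      then have "(as ! i, as ! Suc i) \<in> Map.graph \<alpha>"
        using \<open>path as\<close> by (simp add: path_def graph_def)
      with Suc show ?case by (meson Suc_lessD rtrancl.rtrancl_into_rtrancl)
    qed
    then show ?thesis by (auto simp: in_set_conv_nth)
  qed
  have len: "length as \<le> m" if "path as" for as
  proof -
    have "set as \<subseteq> {1..m}" using reach[OF that] reachable_in_range s IS_ran by blast
    then have "card (set as) \<le> m" using card_mono[of "{1..m}" "set as"] by simp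
    then show ?thesis using that by (simp add: path_def distinct_card)
  qed
  have "path [s]" by (simp add: path_def)
  then obtain as where as: "path as" and longest: "\<And>bs. path bs \<Longrightarrow> length bs \<le> length as"
    using ex_has_greatest_nat[of path "[s]" length "Suc m"] len by (metis le_imp_less_Suc)
  have ne: "as \<noteq> []" and dist: "distinct as" and hd: "hd as = s"
    and step: "\<And>i. Suc i < length as \<Longrightarrow> \<alpha> (as ! i) = Some (as ! Suc i)"
    using as by (auto simp: path_def)
  have "last as \<notin> dom \<alpha>"
  proof
    assume "last as \<in> dom \<alpha>"
    then obtain z where z: "\<alpha> (last as) = Some z" by auto
    have "z \<notin> set as"
    proof
      assume "z \<in> set as"
      then obtain i where i: "i < length as" "as ! i = z" by (auto simp: in_set_conv_nth)
      have "z \<in> ran \<alpha>" using z by (auto simp: ran_def)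
      then have "i \<noteq> 0" using i hd ne s by (metis hd_conv_nth)
      then obtain j where j: "i = Suc j" using not0_implies_Suc by blast
      then have "\<alpha> (as ! j) = Some z" using step i by simp
      then have "as ! j = as ! (length as - 1)"
        using IS_eq_source[OF z] ne by (simp add: last_conv_nth)
      then have "j = length as - 1" using dist i j ne by (simp add: nth_eq_iff_index_eq)
      then show False using i j by simp
    qed
    have "path (as @ [z])"
      unfolding path_def
    proof (intro conjI allI impI)
      fix i assume "Suc i < length (as @ [z])"
      then consider "Suc i < length as" | "i = length as - 1" by fastforce
      then show "\<alpha> ((as @ [z]) ! i) = Some ((as @ [z]) ! Suc i)"
      proof cases
        case 1
        then show ?thesis using step by (simp add: nth_append)
      next
        case 2
        then show ?thesis using z ne by (simp add: nth_append last_conv_nth)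
      qed
    qed (use ne hd dist \<open>z \<notin> set as\<close> in auto)
    then show False using longest by fastforce
  qed
  have "y \<in> set as" if "(s, y) \<in> (Map.graph \<alpha>)\<^sup>*" for y
    using that
  proof (induction rule: rtrancl_induct)
    case base
    then show ?case using ne hd by auto
  next
    case (step y z)
    then obtain i where i: "i < length as" "as ! i = y" by (auto simp: in_set_conv_nth)
    have z: "\<alpha> y = Some z" using step by (simp add: graph_def)
    have "Suc i < length as"
    proof (rule ccontr)
      assume "\<not> Suc i < length as"
      then have "i = length as - 1" using i by simp
      then have "y = last as" using i ne by (simp add: last_conv_nth)
      then show False using z \<open>last as \<notin> dom \<alpha>\<close> by auto
    qed
    then show ?case using \<open>\<And>i. Suc i < length as \<Longrightarrow> _ i\<close> i z by (metis nth_mem option.inject)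
  qed
  then have "set as = (Map.graph \<alpha>)\<^sup>* `` {s}" using reach[OF as] by blast
  moreover have "chain_path \<alpha> as"
    using ne dist step hd s \<open>last as \<notin> dom \<alpha>\<close> by (auto simp: chain_path_def)
  ultimately show ?thesis using that by blast
qed

text \<open>
  Sending a start to its component is a bijection from the points outside the range onto the chains;
  the inverse takes the head of a chain.
\<close>

lemma card_chains: "card (chains m \<alpha>) = m - card (dom \<alpha>)"
proof -
  let ?G = "Map.graph \<alpha>" let ?R = "(?G \<union> ?G\<inverse>)\<^sup>*"
  have R: "equiv UNIV ?R"
    by (rule equivI) (auto simp: refl_rtrancl trans_rtrancl intro: sym_rtrancl sym_Un_converse)
  have "bij_betw (\<lambda>s. ?R `` {s}) ({1..m} - ran \<alpha>) (chains m \<alpha>)"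
    unfolding bij_betw_def
  proof (intro conjI subset_antisym)
    show "inj_on (\<lambda>s. ?R `` {s}) ({1..m} - ran \<alpha>)"
    proof (rule inj_onI)
      fix s t assume st: "s \<in> {1..m} - ran \<alpha>" "t \<in> {1..m} - ran \<alpha>" "?R `` {s} = ?R `` {t}"
      then have "t \<in> ?R `` {s}" by auto
      then have "(s, t) \<in> ?G\<^sup>*" using st component_of_start by auto
      then show "s = t" using reachable_in_range st by blast
    qed
    show "(\<lambda>s. ?R `` {s}) ` ({1..m} - ran \<alpha>) \<subseteq> chains m \<alpha>"
    proof
      fix C assume "C \<in> (\<lambda>s. ?R `` {s}) ` ({1..m} - ran \<alpha>)"
      then obtain s where s: "s \<in> {1..m}" "s \<notin> ran \<alpha>" "C = ?R `` {s}" by auto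
      moreover obtain as where "chain_path \<alpha> as" "set as = ?G\<^sup>* `` {s}"
        using chain_path_from_start[OF s(1,2)] .
      ultimately show "C \<in> chains m \<alpha>"
        using component_of_start[OF s(2)] quotientI[OF s(1), of ?R]
        by (auto simp: chains_def components_def)
    qed
    show "chains m \<alpha> \<subseteq> (\<lambda>s. ?R `` {s}) ` ({1..m} - ran \<alpha>)"
    proof
      fix C assume "C \<in> chains m \<alpha>"
      then obtain x as where x: "x \<in> {1..m}" "C = ?R `` {x}" "chain_path \<alpha> as" "set as = C"
        by (auto simp: chains_def components_def quotient_def)
      let ?s = "hd as"
      have s: "?s \<in> C" "?s \<notin> ran \<alpha>" using x by (auto simp: chain_path_def)
      then have xs: "(x, ?s) \<in> ?R" using x by auto
      then have C: "C = ?R `` {?s}" using x R by (simp add: equiv_class_eq_iff)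
      then have "x \<in> ?G\<^sup>* `` {?s}" using x s component_of_start by auto
      then have "?s \<in> {1..m}"
        using x(1) IS_dom reaching_in_domain by blast
      then show "C \<in> (\<lambda>s. ?R `` {s}) ` ({1..m} - ran \<alpha>)" using C s by blast
    qed
  qed
  then show ?thesis using bij_betw_same_card IS_card_non_ran by fastforce
qed

section \<open>Nilpotency and acyclicity\<close>

text \<open>
  The condition on \<open>x\<close> accounts for the case \<open>r = 0\<close>, where the relational power is the identity on
  all natural numbers, whereas the unit of the semigroup is the identity on \<open>{1..m}\<close>.
\<close>

lemma graph_pow_iff:
  "(\<alpha> [^]\<^bsub>sym_inv m\<^esub> r) x = Some y \<longleftrightarrow> x \<in> {1..m} \<and> (x, y) \<in> Map.graph \<alpha> ^^ r"
proof (induction r arbitrary: x)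
  case 0
  then show ?case by (auto simp: sym_inv_def nat_pow_def restrict_map_def)
next
  case (Suc r)
  have "\<alpha> [^]\<^bsub>sym_inv m\<^esub> Suc r = (\<alpha> [^]\<^bsub>sym_inv m\<^esub> r) \<circ>\<^sub>m \<alpha>"
    by (simp add: nat_pow_def sym_inv_def)
  then have "(\<alpha> [^]\<^bsub>sym_inv m\<^esub> Suc r) x = Some y \<longleftrightarrow>
      (\<exists>z. \<alpha> x = Some z \<and> (\<alpha> [^]\<^bsub>sym_inv m\<^esub> r) z = Some y)"
    by (simp add: map_comp_Some_iff)
  also have "\<dots> \<longleftrightarrow> x \<in> {1..m} \<and> (\<exists>z. \<alpha> x = Some z \<and> (z, y) \<in> Map.graph \<alpha> ^^ r)"
    using Suc.IH IS_dom IS_ran by (blast intro: ranI domI)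
  also have "\<dots> \<longleftrightarrow> x \<in> {1..m} \<and> (x, y) \<in> Map.graph \<alpha> ^^ Suc r"
    by (metis in_graphD in_graphI relpow_Suc_D2 relpow_Suc_I2)
  finally show ?case .
qed

text \<open>
  Running around a cycle gives arbitrarily long walks, so no power vanishes. Conversely, a walk longer
  than the number of arrows can be shortened between the same endpoints; as the graph is single-valued,
  the longer walk has then passed its endpoint before and returns to it, along a cycle.
\<close>

lemma nilpotent_iff_acyclic: "\<alpha> \<in> nilpotents m \<longleftrightarrow> acyclic (Map.graph \<alpha>)"
proof -
  let ?G = "Map.graph \<alpha>"
  have empty: "\<alpha> [^]\<^bsub>sym_inv m\<^esub> r = Map.empty \<longleftrightarrow> ?G ^^ r = {}" if "r > 0" for r
  proof -
    have "x \<in> {1..m}" if "(x, y) \<in> ?G ^^ r" for x y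
      using that \<open>r > 0\<close> IS_dom by (metis domI gr0_conv_Suc in_graphD relpow_Suc_D2 subsetD)
    then have "(\<alpha> [^]\<^bsub>sym_inv m\<^esub> r) x = Some y \<longleftrightarrow> (x, y) \<in> ?G ^^ r" for x y
      using graph_pow_iff by blast
    then show ?thesis by (auto simp: fun_eq_iff) (metis not_None_eq)
  qed
  have "acyclic ?G" if r: "r > 0" "?G ^^ r = {}" for r
  proof (rule acyclicI, intro allI notI)
    fix x assume "(x, x) \<in> ?G\<^sup>+"
    then obtain k where k: "k > 0" "(x, x) \<in> ?G ^^ k" by (auto simp: trancl_power)
    have "(x, x) \<in> ?G ^^ (k * n)" for n
      using k(2) by (induction n) (auto intro: relpow_trans)
    moreover have "?G ^^ (k * r) = ?G ^^ r O ?G ^^ (k * r - r)"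
      using k(1) by (simp flip: relpow_add)
    ultimately show False using r(2) by fastforce
  qed
  moreover have "?G ^^ Suc (card ?G) = {}" if "acyclic ?G"
  proof (rule ccontr)
    assume "?G ^^ Suc (card ?G) \<noteq> {}"
    then obtain x y where xy: "(x, y) \<in> ?G ^^ Suc (card ?G)" by auto
    then obtain n where n: "n \<le> card ?G" "(x, y) \<in> ?G ^^ n"
      using relpow_finite_bounded[OF finite_graph_IS] by blast
    have "(y, y) \<in> ?G ^^ (Suc (card ?G) - n)"
      using single_valued_relpow_add[OF single_valued_graph n(2)] xy n(1) by simp
    moreover have "Suc (card ?G) - n > 0" using n by simp
    ultimately have "(y, y) \<in> ?G\<^sup>+" by (metis trancl_power)
    then show False using that by (simp add: acyclic_def)
  qed
  ultimately have "(\<exists>r>0. ?G ^^ r = {}) \<longleftrightarrow> acyclic ?G" by blast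
  then show ?thesis using empty \<alpha> by (auto simp: nilpotents_def)
qed

text \<open>
  Going backwards from \<open>e\<close> terminates because the graph is finite and acyclic, and the way is forced
  because the map is injective. This is the start that \<open>e\<close> must not be joined to.
\<close>

lemma unique_start_before:
  assumes "acyclic (Map.graph \<alpha>)" "e \<in> {1..m}"
  shows "\<exists>!s. s \<in> {1..m} - ran \<alpha> \<and> (s, e) \<in> (Map.graph \<alpha>)\<^sup>*"
proof -
  let ?G = "Map.graph \<alpha>"
  have "wf ?G" using finite_acyclic_wf[OF finite_graph_IS] assms by blast
  then obtain s where s: "(s, e) \<in> ?G\<^sup>*" "\<And>y. (y, s) \<in> ?G \<Longrightarrow> (y, e) \<notin> ?G\<^sup>*"
    using wfE_min[of ?G e "{y. (y, e) \<in> ?G\<^sup>*}"] by auto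
  have "s \<notin> ran \<alpha>" using s by (auto simp: ran_def graph_def intro: converse_rtrancl_into_rtrancl)
  moreover have "s \<in> {1..m}"
    using s(1) assms(2) IS_dom reaching_in_domain by blast
  moreover have "t = s" if t: "t \<notin> ran \<alpha>" "(t, e) \<in> ?G\<^sup>*" for t
  proof -
    have "single_valued (?G\<inverse>)" by (auto simp: single_valued_def graph_def dest: IS_eq_source)
    moreover have "(e, s) \<in> (?G\<inverse>)\<^sup>*" "(e, t) \<in> (?G\<inverse>)\<^sup>*"
      using s t by (auto simp: rtrancl_converse)
    ultimately have "(s, t) \<in> ?G\<^sup>* \<or> (t, s) \<in> ?G\<^sup>*"
      using single_valued_confluent[of "?G\<inverse>" e s t]
      by (simp only: rtrancl_converse converse_iff) blast
    then show ?thesis using reachable_in_range t \<open>s \<notin> ran \<alpha>\<close> by blast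
  qed
  ultimately show ?thesis using s(1) by blast
qed

end

section \<open>Counting by rank\<close>

lemma IS_remove_arc: "\<alpha> \<in> IS m \<Longrightarrow> \<alpha>(x := None) \<in> IS m"
  by (auto simp: sym_inv_def ran_def inj_on_def split: if_splits)

lemma IS_add_arc:
  "\<beta> \<in> IS m \<Longrightarrow> \<beta> e = None \<Longrightarrow> e \<in> {1..m} \<Longrightarrow> s \<in> {1..m} \<Longrightarrow> s \<notin> ran \<beta> \<Longrightarrow>
   \<beta>(e \<mapsto> s) \<in> IS m"
  by (auto simp: sym_inv_def inj_on_def ran_def)

text \<open>
  Both sides count the elements of rank \<open>k + 1\<close> with property \<open>P\<close> and a marked point of the domain,
  that is, a marked arrow. Erasing the arrow leaves an element of rank \<open>k\<close> together with the endpoints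
  of the arrow, from which the original is recovered; heredity of \<open>P\<close> ensures that the smaller
  element still has property \<open>P\<close>.
\<close>

lemma marked_arc_count:
  assumes hereditary: "\<And>\<alpha> x. \<alpha> \<in> IS m \<Longrightarrow> P \<alpha> \<Longrightarrow> P (\<alpha>(x := None))"
    and extensions: "\<And>\<beta>. \<beta> \<in> IS m \<Longrightarrow> P \<beta> \<Longrightarrow> card (dom \<beta>) = k \<Longrightarrow>
      card {(e, s). e \<in> {1..m} - dom \<beta> \<and> s \<in> {1..m} - ran \<beta> \<and> P (\<beta>(e \<mapsto> s))} = c"
  shows "Suc k * card {\<alpha> \<in> IS m. P \<alpha> \<and> card (dom \<alpha>) = Suc k}
       = c * card {\<beta> \<in> IS m. P \<beta> \<and> card (dom \<beta>) = k}"
proof -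
  let ?F = "\<lambda>k. {\<alpha> \<in> IS m. P \<alpha> \<and> card (dom \<alpha>) = k}"
  let ?E = "\<lambda>\<beta>. {(e, s). e \<in> {1..m} - dom \<beta> \<and> s \<in> {1..m} - ran \<beta> \<and> P (\<beta>(e \<mapsto> s))}"
  let ?cut = "\<lambda>(\<alpha>, x). (\<alpha>(x := None), x, the (\<alpha> x))"
  let ?glue = "\<lambda>(\<beta>, e, s). (\<beta>(e \<mapsto> s), e)"
  have fin: "finite (?F k)" for k using finite_IS by simp
  have finE: "finite (?E \<beta>)" for \<beta> :: "nat \<rightharpoonup> nat"
    by (rule finite_subset[of _ "{1..m} \<times> {1..m}"]) auto
  have "bij_betw ?cut (SIGMA \<alpha>:?F (Suc k). dom \<alpha>) (SIGMA \<beta>:?F k. ?E \<beta>)"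
  proof (rule bij_betw_byWitness[where f' = ?glue])
    show "\<forall>a\<in>(SIGMA \<alpha>:?F (Suc k). dom \<alpha>). ?glue (?cut a) = a" by auto
    show "\<forall>b\<in>(SIGMA \<beta>:?F k. ?E \<beta>). ?cut (?glue b) = b"
      by (auto simp: dom_def fun_upd_idem)
    show "?cut ` (SIGMA \<alpha>:?F (Suc k). dom \<alpha>) \<subseteq> (SIGMA \<beta>:?F k. ?E \<beta>)"
    proof (rule image_subsetI)
      fix p assume "p \<in> (SIGMA \<alpha>:?F (Suc k). dom \<alpha>)"
      then obtain \<alpha> x y where p: "p = (\<alpha>, x)"
        and \<alpha>: "\<alpha> \<in> IS m" "P \<alpha>" "card (dom \<alpha>) = Suc k" "\<alpha> x = Some y" by auto
      have "\<alpha>(x := None) \<in> IS m" "P (\<alpha>(x := None))"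
        using \<alpha> IS_remove_arc hereditary by auto
      moreover have "card (dom (\<alpha>(x := None))) = k"
        using \<alpha> IS_finite_dom[OF \<alpha>(1)] by (simp add: domI)
      moreover have "x \<in> {1..m} - dom (\<alpha>(x := None))" using IS_dom[OF \<alpha>(1)] \<alpha>(4) by auto
      moreover have "y \<in> {1..m} - ran (\<alpha>(x := None))"
        using IS_ran[OF \<alpha>(1)] IS_eq_source[OF \<alpha>(1)] \<alpha>(4)
        by (auto simp: ran_def split: if_splits)
      moreover have "P (\<alpha>(x := None, x \<mapsto> y))" using \<alpha> by (simp add: fun_upd_idem)
      ultimately show "?cut p \<in> (SIGMA \<beta>:?F k. ?E \<beta>)"
        unfolding p using \<alpha>(4) by (simp del: fun_upd_upd)
    qed
    show "?glue ` (SIGMA \<beta>:?F k. ?E \<beta>) \<subseteq> (SIGMA \<alpha>:?F (Suc k). dom \<alpha>)"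
      by (auto simp: IS_add_arc IS_finite_dom card_insert_if)
  qed
  then have "card (SIGMA \<alpha>:?F (Suc k). dom \<alpha>) = card (SIGMA \<beta>:?F k. ?E \<beta>)"
    by (rule bij_betw_same_card)
  moreover have "card (SIGMA \<alpha>:?F (Suc k). dom \<alpha>) = Suc k * card (?F (Suc k))"
    using fin by (subst card_SigmaI) (auto simp: IS_finite_dom)
  moreover have "card (SIGMA \<beta>:?F k. ?E \<beta>) = c * card (?F k)"
    using fin finE extensions by (subst card_SigmaI) auto
  ultimately show ?thesis by simp
qed

definition IS_of_rank :: "nat \<Rightarrow> nat \<Rightarrow> (nat \<rightharpoonup> nat) set" where
  "IS_of_rank m k = {\<alpha> \<in> IS m. card (dom \<alpha>) = k}"

definition nilpotents_of_rank :: "nat \<Rightarrow> nat \<Rightarrow> (nat \<rightharpoonup> nat) set" where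
  "nilpotents_of_rank m k = {\<alpha> \<in> nilpotents m. card (dom \<alpha>) = k}"

lemma nilpotents_of_rank_acyclic:
  "nilpotents_of_rank m k = {\<alpha> \<in> IS m. acyclic (Map.graph \<alpha>) \<and> card (dom \<alpha>) = k}"
  using nilpotent_iff_acyclic by (auto simp: nilpotents_of_rank_def nilpotents_def)

lemma card_IS_of_rank_Suc:
  "Suc k * card (IS_of_rank m (Suc k)) = (m - k) * (m - k) * card (IS_of_rank m k)"
proof -
  have "card {(e, s). e \<in> {1..m} - dom \<beta> \<and> s \<in> {1..m} - ran \<beta> \<and> True} = (m - k) * (m - k)"
    if "\<beta> \<in> IS m" "card (dom \<beta>) = k" for \<beta>
  proof -
    have "{(e, s). e \<in> {1..m} - dom \<beta> \<and> s \<in> {1..m} - ran \<beta> \<and> True}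
      = ({1..m} - dom \<beta>) \<times> ({1..m} - ran \<beta>)" by auto
    then show ?thesis
      using that IS_card_non_dom IS_card_non_ran by (simp only: card_cartesian_product)
  qed
  then show ?thesis
    using marked_arc_count[of m "\<lambda>_. True" k "(m - k) * (m - k)"] by (simp add: IS_of_rank_def)
qed

lemma acyclic_add_arc:
  assumes "\<beta> e = None"
  shows "acyclic (Map.graph (\<beta>(e \<mapsto> s))) \<longleftrightarrow>
     acyclic (Map.graph \<beta>) \<and> (s, e) \<notin> (Map.graph \<beta>)\<^sup>*"
proof -
  have "Map.graph (\<beta>(e \<mapsto> s)) = insert (e, s) (Map.graph \<beta>)"
    using assms by (auto simp: graph_def split: if_splits)
  then show ?thesis by (simp only: acyclic_insert)
qed

text \<open>
  Each of the \<open>m - k\<close> chain ends can be joined to every chain start except that of its own chain,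
  which would close a cycle.
\<close>

lemma card_nilpotents_of_rank_Suc:
  "Suc k * card (nilpotents_of_rank m (Suc k)) =
   (m - k) * (m - k - 1) * card (nilpotents_of_rank m k)"
proof -
  let ?P = "\<lambda>\<alpha>. acyclic (Map.graph \<alpha>)"
  have "?P (\<alpha>(x := None))" if "?P \<alpha>" for \<alpha> :: "nat \<rightharpoonup> nat" and x
    using that by (rule acyclic_subset) (auto simp: graph_def split: if_splits)
  moreover have "card {(e, s). e \<in> {1..m} - dom \<beta> \<and> s \<in> {1..m} - ran \<beta> \<and> ?P (\<beta>(e \<mapsto> s))}
     = (m - k) * (m - k - 1)"
    if \<beta>: "\<beta> \<in> IS m" "?P \<beta>" "card (dom \<beta>) = k" for \<beta>
  proof -
    let ?S = "\<lambda>e. {s \<in> {1..m} - ran \<beta>. (s, e) \<notin> (Map.graph \<beta>)\<^sup>*}"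
    have "card (?S e) = m - k - 1" if "e \<in> {1..m} - dom \<beta>" for e
    proof -
      obtain s where s: "s \<in> {1..m} - ran \<beta>"
        "\<And>t. t \<in> {1..m} - ran \<beta> \<Longrightarrow> (t, e) \<in> (Map.graph \<beta>)\<^sup>* \<longleftrightarrow> t = s"
        using unique_start_before[OF \<beta>(1,2)] \<open>e \<in> {1..m} - dom \<beta>\<close> by blast
      then have "?S e = {1..m} - ran \<beta> - {s}" by auto
      then show ?thesis using s(1) IS_card_non_ran[OF \<beta>(1)] \<beta>(3) by simp
    qed
    moreover have "{(e, s). e \<in> {1..m} - dom \<beta> \<and> s \<in> {1..m} - ran \<beta> \<and> ?P (\<beta>(e \<mapsto> s))}
        = (SIGMA e:{1..m} - dom \<beta>. ?S e)"
      using \<beta>(2) by (auto simp: acyclic_add_arc simp del: graph_map_upd)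
    ultimately show ?thesis using IS_card_non_dom[OF \<beta>(1)] \<beta>(3) by simp
  qed
  ultimately show ?thesis
    using marked_arc_count[of m ?P k "(m - k) * (m - k - 1)"]
    by (simp add: nilpotents_of_rank_acyclic)
qed

lemma card_rank_0: "card (IS_of_rank m 0) = 1" "card (nilpotents_of_rank m 0) = 1"
proof -
  have "IS_of_rank m 0 = {Map.empty}"
    using IS_finite_dom by (auto simp: IS_of_rank_def) (auto simp: sym_inv_def)
  moreover have "nilpotents_of_rank m 0 = {\<alpha> \<in> IS_of_rank m 0. acyclic (Map.graph \<alpha>)}"
    by (auto simp: nilpotents_of_rank_acyclic IS_of_rank_def)
  ultimately show "card (IS_of_rank m 0) = 1" "card (nilpotents_of_rank m 0) = 1"
    by (auto simp: acyclic_def Collect_conv_if)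
qed

section \<open>Comparing the two rank distributions\<close>

text \<open>
  Passing from rank \<open>k\<close> to \<open>k + 1\<close> multiplies the two counts by factors whose ratio is
  \<open>(m - k - 1) / (m - k)\<close>. The ratios telescope, so for \<open>k \<le> m\<close> and \<open>m > 0\<close> a proportion of
  \<open>(m - k) / m\<close> of the elements of rank \<open>k\<close> is nilpotent.
\<close>

lemma card_nilpotents_of_rank_eq:
  "m * card (nilpotents_of_rank m k) = (m - k) * card (IS_of_rank m k)"
proof (induction k)
  case 0
  show ?case by (simp add: card_rank_0)
next
  case (Suc k)
  have "Suc k * (m * card (nilpotents_of_rank m (Suc k))) =
      m * (Suc k * card (nilpotents_of_rank m (Suc k)))"
    by (simp only: ac_simps)
  also have "\<dots> = (m - k) * (m - k - 1) * (m * card (nilpotents_of_rank m k))"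
    unfolding card_nilpotents_of_rank_Suc by (simp only: ac_simps)
  also have "\<dots> = (m - Suc k) * ((m - k) * (m - k) * card (IS_of_rank m k))"
    unfolding Suc.IH by (simp add: ac_simps)
  also have "\<dots> = Suc k * ((m - Suc k) * card (IS_of_rank m (Suc k)))"
    unfolding card_IS_of_rank_Suc[symmetric] by (simp only: ac_simps)
  finally show ?case by (metis mult_left_cancel nat.distinct(1))
qed

text \<open>
  The recurrences of \<open>IS m\<close> and of the nilpotents on \<open>m + 1\<close> points have the factors \<open>(m - k)^2\<close> and
  \<open>(m + 1 - k) (m - k)\<close>, and again the ratios telescope.
\<close>

lemma card_IS_of_rank_eq:
  "Suc m * card (IS_of_rank m k) = (Suc m - k) * card (nilpotents_of_rank (Suc m) k)"
proof (induction k)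
  case 0
  show ?case by (simp add: card_rank_0)
next
  case (Suc k)
  have "Suc k * (Suc m * card (IS_of_rank m (Suc k))) =
      Suc m * (Suc k * card (IS_of_rank m (Suc k)))"
    by (simp only: ac_simps)
  also have "\<dots> = (m - k) * (m - k) * (Suc m * card (IS_of_rank m k))"
    unfolding card_IS_of_rank_Suc by (simp only: ac_simps)
  also have "\<dots> = (Suc m - Suc k) *
      ((Suc m - k) * (Suc m - k - 1) * card (nilpotents_of_rank (Suc m) k))"
    unfolding Suc.IH by (simp add: ac_simps)
  also have "\<dots> = Suc k * ((Suc m - Suc k) * card (nilpotents_of_rank (Suc m) (Suc k)))"
    unfolding card_nilpotents_of_rank_Suc[symmetric] by (simp only: ac_simps)
  finally show ?case by (metis mult_left_cancel nat.distinct(1))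
qed

text \<open>
  The cutoff \<open>n\<close> may exceed \<open>m\<close>, because \<open>card_IS_of_rank_eq\<close> has to be summed over the ranks up to
  \<open>m + 1\<close>, the range of summation in \<open>L_nil (m + 1)\<close>.
\<close>

lemma sum_by_rank:
  assumes "A \<subseteq> IS m" "m \<le> n"
  shows "(\<Sum>\<alpha>\<in>A. f (card (dom \<alpha>))) = (\<Sum>k\<le>n. f k * card {\<alpha> \<in> A. card (dom \<alpha>) = k})"
proof -
  have "(\<Sum>\<alpha>\<in>A. f (card (dom \<alpha>))) =
      (\<Sum>k\<le>n. \<Sum>\<alpha> | \<alpha> \<in> A \<and> card (dom \<alpha>) = k. f (card (dom \<alpha>)))"
  proof (rule sum.group[symmetric])
    show "finite A" using assms(1) finite_IS finite_subset by blast
    show "(\<lambda>\<alpha>. card (dom \<alpha>)) ` A \<subseteq> {..n}"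
      using assms IS_card_dom_le by (auto intro: order_trans)
  qed simp
  also have "\<dots> = (\<Sum>k\<le>n. f k * card {\<alpha> \<in> A. card (dom \<alpha>) = k})"
    by (rule sum.cong) auto
  finally show ?thesis .
qed

lemma nilpotents_subset_IS: "nilpotents m \<subseteq> IS m"
  by (auto simp: nilpotents_def)

lemma L_all_by_rank: "L_all m = (\<Sum>k\<le>m. (m - k) * card (IS_of_rank m k))"
  unfolding L_all_def IS_of_rank_def by (simp add: card_chains sum_by_rank[of _ m m "\<lambda>k. m - k"])

lemma L_nil_by_rank: "L_nil m = (\<Sum>k\<le>m. (m - k) * card (nilpotents_of_rank m k))"
proof -
  have "L_nil m = (\<Sum>\<alpha>\<in>nilpotents m. m - card (dom \<alpha>))"
    unfolding L_nil_def
    by (intro sum.cong refl card_chains) (use nilpotents_subset_IS in blast)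
  then show ?thesis
    unfolding nilpotents_of_rank_def
    by (simp add: sum_by_rank[of _ m m "\<lambda>k. m - k"] nilpotents_subset_IS)
qed

lemma card_nilpotents_eq_L_all: "n * card (nilpotents n) = L_all n"
  using sum_by_rank[of "nilpotents n" n n "\<lambda>_. 1"] nilpotents_subset_IS
  by (simp add: L_all_by_rank nilpotents_of_rank_def[symmetric] sum_distrib_left
      card_nilpotents_of_rank_eq)

lemma card_IS_eq_L_nil: "Suc n * card (IS n) = L_nil (Suc n)"
proof -
  have "card (IS n) = (\<Sum>k\<le>Suc n. card (IS_of_rank n k))"
    using sum_by_rank[of "IS n" n "Suc n" "\<lambda>_. 1"] unfolding IS_of_rank_def by simp
  then show ?thesis by (simp only: sum_distrib_left card_IS_of_rank_eq L_nil_by_rank)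
qed

theorem theorem6:
  fixes n :: nat
  assumes "n \<ge> 1"
  shows "real (card (nilpotents n)) = 1 / real n * real (L_all n) \<and>
         real (card (IS n)) = 1 / real (n + 1) * real (L_nil (n + 1))"
proof
  show "real (card (nilpotents n)) = 1 / real n * real (L_all n)"
    using assms by (simp flip: card_nilpotents_eq_L_all)
  show "real (card (IS n)) = 1 / real (n + 1) * real (L_nil (n + 1))"
    by (simp add: card_IS_eq_L_nil[symmetric] field_simps)
qed

end
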